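(* Let $w$ be any standard monomial of $\mathbf R=\operatorname{Lie}(v_0,v_1)$, and let $(Z_1,Z_2)=(\operatorname{wt}(w),\operatorname{swt}(w))$ be its weight coordinates. Then $$-\tfrac12\log_2 Z_1-\tfrac52<Z_2<\tfrac12\log_2 Z_1+2 .$$
   Context: Let $K$ be a field and $\Lambda=\Lambda(x_i\mid i\ge 0)$ the Grassmann (exterior) algebra over $K$ on odd generators $x_0,x_1,\dots$. In $\operatorname{End}\Lambda$ identify $x_i$ with left multiplication by $x_i$, and let $\partial_i$ be the odd superderivation of $\Lambda$ with $\partial_i(x_j)=\delta_{ij}$. The pivot elements are $v_i=\partial_i+x_ix_{i+1}(\partial_{i+2}+x_{i+2}x_{i+3}(\partial_{i+4}+\cdots))$, $i\ge 0$, i.e. $v_i=\partial_i+x_ix_{i+1}v_{i+2}$; $\mathbf R$ is the Lie superalgebra generated by $v_0,v_1$ under the supercommutator $[a,b]=ab-(-1)^{\deg a\deg b}ba$ (and squares of odd elements if $\operatorname{char}K=2$). A tail monomial is $r_m=x_0^{\xi_0}\cdots x_m^{\xi_m}$, $\xi_i\in\{0,1\}$ ($r_m=1$ for $m<0$). Standard monomials are: first type $r_{n-2}v_n$, $n\ge 0$; second type $r_{n-3}x_{n-1}v_n$, $n\ge 2$, with $x_0x_2v_3$ excluded. (They form a basis of $\mathbf R$ when $\operatorname{char}K\ne 2$.) The weight and superweight of monomials in the $x_i,v_i$ are defined additively on products by $\operatorname{wt}(v_n)=-\operatorname{wt}(x_n)=2^n$ and $\operatorname{swt}(v_n)=-\operatorname{swt}(x_n)=(-1)^n$.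 *)

theory Defs
  imports Complex_Main "HOL-Library.FSet" "HOL-Library.Poly_Mapping" "HOL-Library.Groups_Big_Fun"
begin

section \<open>The Grassmann algebra\<close>

text \<open>An element of the Grassmann algebra on \<open>x\<^sub>0, x\<^sub>1, \<dots>\<close> is stored by its coordinates in the
  basis \<open>e\<^sub>A = x\<^sub>a \<cdots> x\<^sub>b\<close> (factors in increasing order), where \<open>A\<close> runs over the finite subsets
  of the naturals.\<close>

type_synonym 'k grassmann = "nat fset \<Rightarrow>\<^sub>0 'k"

text \<open>The sign in \<open>e\<^sub>A e\<^sub>B = \<plusminus> e\<^bsub>A\<union>B\<^esub>\<close> for disjoint \<open>A\<close>, \<open>B\<close>: one transposition for every pair
  \<open>a \<in> A\<close>, \<open>b \<in> B\<close> with \<open>b < a\<close>.\<close>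

definition gsign :: "nat fset \<Rightarrow> nat fset \<Rightarrow> 'k::field" where
  "gsign A B = (- 1) ^ (\<Sum>a\<in>fset A. card {b \<in> fset B. b < a})"

lift_definition gmult :: "'k::field grassmann \<Rightarrow> 'k grassmann \<Rightarrow> 'k grassmann" (infixl "\<star>" 70)
  is "\<lambda>f g C. \<Sum>A\<in>fset (fPow C). gsign A (C |-| A) * f A * g (C |-| A)"
proof -
  fix f g :: "nat fset \<Rightarrow> 'k"
  assume f: "finite {A. f A \<noteq> 0}" and g: "finite {A. g A \<noteq> 0}"
  have "{C. (\<Sum>A\<in>fset (fPow C). gsign A (C |-| A) * f A * g (C |-| A)) \<noteq> 0}
      \<subseteq> (\<lambda>(A, B). A |\<union>| B) ` ({A. f A \<noteq> 0} \<times> {A. g A \<noteq> 0})"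
  proof
    fix C assume "C \<in> {C. (\<Sum>A\<in>fset (fPow C). gsign A (C |-| A) * f A * g (C |-| A)) \<noteq> 0}"
    then obtain A where "A |\<in>| fPow C" "gsign A (C |-| A) * f A * g (C |-| A) \<noteq> 0"
      by (metis (mono_tags, lifting) mem_Collect_eq sum.neutral)
    then have "A |\<subseteq>| C" "f A \<noteq> 0" "g (C |-| A) \<noteq> 0" by auto
    moreover from \<open>A |\<subseteq>| C\<close> have "C = A |\<union>| (C |-| A)" by auto
    ultimately show "C \<in> (\<lambda>(A, B). A |\<union>| B) ` ({A. f A \<noteq> 0} \<times> {A. g A \<noteq> 0})"
      by (intro image_eqI[where x = "(A, C |-| A)"]) auto
  qed
  then show "finite {C. (\<Sum>A\<in>fset (fPow C). gsign A (C |-| A) * f A * g (C |-| A)) \<noteq> 0}"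
    by (rule finite_subset) (use f g in auto)
qed

definition gone :: "'k::field grassmann" where
  "gone = Poly_Mapping.single {||} 1"

definition gen :: "nat \<Rightarrow> 'k::field grassmann" where
  "gen i = Poly_Mapping.single {|i|} 1"

lift_definition parity :: "'k::field grassmann \<Rightarrow> 'k grassmann"
  is "\<lambda>f A. (- 1) ^ card (fset A) * f A"
  by (rule rev_finite_subset, assumption) auto


section \<open>The operators \<open>x\<^sub>i\<close>, \<open>\<partial>\<^sub>i\<close> and \<open>v\<^sub>i\<close> on the Grassmann algebra\<close>

definition xop :: "nat \<Rightarrow> 'k::field grassmann \<Rightarrow> 'k grassmann" where
  "xop i f = gen i \<star> f"

text \<open>\<open>\<partial>\<^sub>i\<close> in coordinates: it maps \<open>e\<^bsub>A\<union>{i}\<^esub>\<close> to \<open>\<plusminus> e\<^sub>A\<close>, moving \<open>x\<^sub>i\<close> to the front, and \<open>e\<^sub>A\<close> to \<open>0\<close>,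
  for \<open>i \<notin> A\<close>. The lemmas \<open>pd_gen\<close> and \<open>pd_Leibniz\<close> below show that it is the odd superderivation
  with \<open>\<partial>\<^sub>i(x\<^sub>j) = \<delta>\<^sub>i\<^sub>j\<close>.\<close>

lift_definition pd :: "nat \<Rightarrow> 'k::field grassmann \<Rightarrow> 'k grassmann"
  is "\<lambda>i f A. if i |\<in>| A then 0 else (- 1) ^ card {j \<in> fset A. j < i} * f (finsert i A)"
proof -
  fix i :: nat and f :: "nat fset \<Rightarrow> 'k"
  assume f: "finite {A. f A \<noteq> 0}"
  have "{A. (if i |\<in>| A then 0 else (- 1) ^ card {j \<in> fset A. j < i} * f (finsert i A)) \<noteq> 0}
      \<subseteq> (\<lambda>A. A |-| {|i|}) ` {A. f A \<noteq> 0}"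
  proof
    fix A assume "A \<in> {A. (if i |\<in>| A then 0
      else (- 1) ^ card {j \<in> fset A. j < i} * f (finsert i A)) \<noteq> 0}"
    then have "i |\<notin>| A" "f (finsert i A) \<noteq> 0" by (auto split: if_splits)
    then show "A \<in> (\<lambda>A. A |-| {|i|}) ` {A. f A \<noteq> 0}"
      by (intro image_eqI[where x = "finsert i A"]) auto
  qed
  then show "finite {A. (if i |\<in>| A then 0
      else (- 1) ^ card {j \<in> fset A. j < i} * f (finsert i A)) \<noteq> 0}"
    by (rule finite_subset) (use f in auto)
qed

text \<open>The infinite sum \<open>v\<^sub>i = \<Sum>\<^sub>k x\<^sub>i x\<^bsub>i+1\<^esub> \<cdots> x\<^bsub>i+2k-1\<^esub> \<partial>\<^bsub>i+2k\<^esub>\<close>. Only finitely many terms are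
  nonzero at any given element of the algebra, so \<open>Sum_any\<close> is the intended sum; see \<open>vop_rec\<close>.\<close>

definition vop :: "nat \<Rightarrow> 'k::field grassmann \<Rightarrow> 'k grassmann" where
  "vop i f = Sum_any (\<lambda>k. foldr (\<circ>) (map xop [i..<i + 2 * k]) id (pd (i + 2 * k) f))"


subsection \<open>The defining relations\<close>

lemma gsign_Diff_singleton:
  "gsign {|i|} B = ((- 1) ^ card {b \<in> fset B. b < i} :: 'k::field)"
  by (simp add: gsign_def)

lemma gmult_add_right: "f \<star> (g + h) = f \<star> g + f \<star> h"
  by (rule poly_mapping_eqI)
     (simp add: gmult.rep_eq lookup_add sum.distrib algebra_simps)

lemma gmult_zero_right [simp]: "f \<star> 0 = 0"
  by (rule poly_mapping_eqI) (simp add: gmult.rep_eq)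

lemma lookup_xop:
  "Poly_Mapping.lookup (xop i f) C =
    (if i |\<in>| C then (- 1) ^ card {j \<in> fset C. j < i} * Poly_Mapping.lookup f (C |-| {|i|}) else 0)"
proof -
  have "Poly_Mapping.lookup (xop i f) C =
    (\<Sum>A\<in>fset (fPow C). if A = {|i|}
       then gsign {|i|} (C |-| {|i|}) * Poly_Mapping.lookup f (C |-| {|i|}) else 0)"
    unfolding xop_def gen_def gmult.rep_eq
    by (intro sum.cong) (auto simp: lookup_single when_def)
  also have "\<dots> = (if {|i|} |\<in>| fPow C
       then gsign {|i|} (C |-| {|i|}) * Poly_Mapping.lookup f (C |-| {|i|}) else 0)"
    by simp
  moreover have "{j \<in> fset C. j < i} = {b \<in> fset C - {i}. b < i}" by auto
  ultimately show ?thesis by (simp add: gsign_Diff_singleton)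
qed

lemma gone_left: "gone \<star> f = f"
proof (rule poly_mapping_eqI)
  fix C
  have "Poly_Mapping.lookup (gone \<star> f) C =
    (\<Sum>A\<in>fset (fPow C). if A = {||} then Poly_Mapping.lookup f C else 0)"
    unfolding gone_def gmult.rep_eq
    by (intro sum.cong) (auto simp: lookup_single when_def gsign_def)
  then show "Poly_Mapping.lookup (gone \<star> f) C = Poly_Mapping.lookup f C" by simp
qed

lemma xop_square: "xop i (xop i f) = 0"
  by (rule poly_mapping_eqI) (simp add: lookup_xop)

lemma xop_anticommute:
  assumes "i \<noteq> j"
  shows "xop i (xop j f) = - xop j (xop i f)"
proof -
  have main: "xop a (xop b f) = - xop b (xop a f)" if ab: "a < b" for a b
  proof (rule poly_mapping_eqI)
    fix C
    have "{k \<in> fset C - {b}. k < a} = {k \<in> fset C. k < a}" using ab by auto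
    moreover have "{k \<in> fset C. k < b} = insert a {k \<in> fset C - {a}. k < b}" if "a |\<in>| C"
      using ab that by auto
    then have "card {k \<in> fset C. k < b} = Suc (card {k \<in> fset C - {a}. k < b})" if "a |\<in>| C"
      using that by (simp add: card_insert_if)
    moreover have "C |-| {|a|} |-| {|b|} = C |-| {|b|} |-| {|a|}" by auto
    ultimately show "Poly_Mapping.lookup (xop a (xop b f)) C = Poly_Mapping.lookup (- xop b (xop a f)) C"
      using ab by (simp add: lookup_xop)
  qed
  show ?thesis using main[of i j] main[of j i] assms by (cases "i < j") auto
qed

text \<open>The basis element \<open>e\<^sub>A\<close> is the increasing product of the generators.\<close>

lemma basis_increasing_product:
  assumes "\<And>a. a |\<in>| A \<Longrightarrow> i < a"
  shows "xop i (Poly_Mapping.single A (1::'k::field)) = Poly_Mapping.single (finsert i A) 1"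
proof (rule poly_mapping_eqI)
  fix C
  have i: "i |\<notin>| A" using assms by auto
  show "Poly_Mapping.lookup (xop i (Poly_Mapping.single A (1::'k))) C =
    Poly_Mapping.lookup (Poly_Mapping.single (finsert i A) 1) C"
  proof (cases "C = finsert i A")
    case True
    then have "C |-| {|i|} = A" using i by auto
    moreover have "card {j \<in> fset C. j < i} = 0" using assms True by fastforce
    ultimately show ?thesis using True by (simp only: lookup_xop) simp
  next
    case False
    then have "i |\<in>| C \<Longrightarrow> A \<noteq> C |-| {|i|}" by auto
    then show ?thesis using False by (auto simp: lookup_xop lookup_single when_def)
  qed
qed

lemma pd_gen: "pd i (gen j) = (if i = j then gone else 0)"
proof (rule poly_mapping_eqI)
  fix C
  have "finsert i C = {|j|} \<longleftrightarrow> i = j \<and> C = {||}" if "i |\<notin>| C"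
    using that by auto
  then show "Poly_Mapping.lookup (pd i (gen j)) C =
      Poly_Mapping.lookup (if i = j then gone else 0) C"
    by (auto simp: pd.rep_eq gen_def gone_def lookup_single when_def)
qed

lemma pd_add: "pd i (f + g) = pd i f + pd i g"
  by (rule poly_mapping_eqI) (simp add: pd.rep_eq lookup_add algebra_simps)

lemma card_less_finsert:
  assumes "i |\<notin>| B"
  shows "card {b. (b = i \<or> b |\<in>| B) \<and> b < (a::nat)} =
    card {b. b |\<in>| B \<and> b < a} + (if i < a then 1 else 0)"
proof -
  have "{b. (b = i \<or> b |\<in>| B) \<and> b < a} =
      (if i < a then insert i {b. b |\<in>| B \<and> b < a} else {b. b |\<in>| B \<and> b < a})"
    by auto
  then show ?thesis using assms by auto
qed

lemma gsign_finsert_left: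
  assumes "i |\<notin>| A"
  shows "gsign (finsert i A) B = ((- 1) ^ card {b \<in> fset B. b < i} * gsign A B :: 'k::field)"
  using assms by (simp add: gsign_def power_add)

lemma gsign_finsert_right:
  assumes "i |\<notin>| B"
  shows "gsign A (finsert i B) = ((- 1) ^ card {a \<in> fset A. i < a} * gsign A B :: 'k::field)"
proof -
  have "(\<Sum>a\<in>fset A. card {b \<in> fset (finsert i B). b < a}) =
     (\<Sum>a\<in>fset A. card {b \<in> fset B. b < a}) + (\<Sum>a\<in>fset A. if i < a then 1 else 0)"
    using card_less_finsert[OF assms] by (simp add: sum.distrib)
  also have "(\<Sum>a\<in>fset A. if i < a then 1 else (0::nat)) = card {a \<in> fset A. i < a}"
    by (simp add: sum.If_cases Int_def)
  finally show ?thesis by (simp add: gsign_def power_add mult.commute)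
qed

lemma sum_fPow_finsert:
  assumes "i |\<notin>| D"
  shows "(\<Sum>A\<in>fset (fPow (finsert i D)). h A) =
    (\<Sum>A\<in>fset (fPow D). h A + h (finsert i A) :: 'a::comm_monoid_add)"
proof -
  have "fset (fPow (finsert i D)) = fset (fPow D) \<union> finsert i ` fset (fPow D)"
  proof (intro equalityI subsetI)
    fix A assume A: "A \<in> fset (fPow (finsert i D))"
    show "A \<in> fset (fPow D) \<union> finsert i ` fset (fPow D)"
    proof (cases "i |\<in>| A")
      case True
      then have "A = finsert i (A |-| {|i|})" by auto
      moreover have "A |-| {|i|} \<in> fset (fPow D)" using A by auto
      ultimately show ?thesis by blast
    next
      case False
      then show ?thesis using A by auto
    qed
  qed auto
  moreover have "fset (fPow D) \<inter> finsert i ` fset (fPow D) = {}"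
    using assms by auto
  moreover have "inj_on (finsert i) (fset (fPow D))"
  proof (rule inj_onI)
    fix A B assume AB: "A \<in> fset (fPow D)" "B \<in> fset (fPow D)" "finsert i A = finsert i B"
    have "i |\<notin>| A" "i |\<notin>| B" using AB assms by auto
    then show "A = B" using AB(3) by (metis finsert_fminus_single fminus_finsert_absorb fset_eq_fsubset fminus_finsert2 fminus_fempty finsert_ident)
  qed
  ultimately show ?thesis
    by (simp add: sum.union_disjoint sum.reindex sum.distrib)
qed

lemma pd_Leibniz: "pd i (f \<star> g) = pd i f \<star> g + parity f \<star> pd i g"
proof (rule poly_mapping_eqI)
  fix C
  let ?f = "Poly_Mapping.lookup f" and ?g = "Poly_Mapping.lookup g"
  let ?l = "\<lambda>A. card {j \<in> fset A. j < i}"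
  have split: "card (fset A) = ?l A + card {a \<in> fset A. i < a}" if "i |\<notin>| A" for A
  proof -
    have "fset A = {j \<in> fset A. j < i} \<union> {a \<in> fset A. i < a}"
      using that by (auto simp: not_less_iff_gr_or_eq)
    then have "card (fset A) = card ({j \<in> fset A. j < i} \<union> {a \<in> fset A. i < a})"
      by simp
    also have "\<dots> = ?l A + card {a \<in> fset A. i < a}" by (rule card_Un_disjoint) auto
    finally show ?thesis .
  qed
  have l: "?l D = ?l A + ?l (D |-| A)" if "A |\<subseteq>| D" for A D
  proof -
    have "{j \<in> fset D. j < i} = {j \<in> fset A. j < i} \<union> {j \<in> fset (D |-| A). j < i}"
      using that by auto
    then have "?l D = card ({j \<in> fset A. j < i} \<union> {j \<in> fset (D |-| A). j < i})" by simp
    also have "\<dots> = ?l A + ?l (D |-| A)" by (rule card_Un_disjoint) auto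
    finally show ?thesis .
  qed
  have d: "finsert i D |-| A = finsert i (D |-| A)" "finsert i D |-| finsert i A = D |-| A"
    if "A |\<subseteq>| D" "i |\<notin>| D" for A D
    using that by auto
  show "Poly_Mapping.lookup (pd i (f \<star> g)) C =
    Poly_Mapping.lookup (pd i f \<star> g + parity f \<star> pd i g) C"
  proof (cases "i |\<in>| C")
    case True
    define D where "D = C |-| {|i|}"
    have C: "C = finsert i D" and D: "i |\<notin>| D" using True by (auto simp: D_def)
    let ?h = "\<lambda>A. gsign A (C |-| A) * Poly_Mapping.lookup (pd i f) A * ?g (C |-| A)
      + gsign A (C |-| A) * Poly_Mapping.lookup (parity f) A
          * Poly_Mapping.lookup (pd i g) (C |-| A)"
    have "Poly_Mapping.lookup (pd i f \<star> g + parity f \<star> pd i g) C = (\<Sum>A\<in>fset (fPow C). ?h A)"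
      by (simp only: lookup_add gmult.rep_eq sum.distrib)
    also have "\<dots> = (\<Sum>A\<in>fset (fPow D). ?h A + ?h (finsert i A))"
      unfolding C by (rule sum_fPow_finsert[OF D])
    also have "\<dots> = 0"
    proof (rule sum.neutral, rule ballI)
      fix A assume "A \<in> fset (fPow D)"
      then have A: "A |\<subseteq>| D" by simp
      then have i: "i |\<notin>| A" "i |\<notin>| D |-| A" using D by auto
      show "?h A + ?h (finsert i A) = 0"
        using i split[OF i(1)] unfolding C d[OF A D]
        by (simp add: pd.rep_eq parity.rep_eq gsign_finsert_left gsign_finsert_right power_add
            left_minus_one_mult_self)
    qed
    finally show ?thesis using True by (simp add: pd.rep_eq)
  next
    case False
    let ?t = "\<lambda>A. gsign A (finsert i C |-| A) * ?f A * ?g (finsert i C |-| A)"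
    have "Poly_Mapping.lookup (pd i (f \<star> g)) C =
        (- 1) ^ ?l C * (\<Sum>A\<in>fset (fPow (finsert i C)). ?t A)"
      using False by (simp add: pd.rep_eq gmult.rep_eq del: fPow_finsert)
    also have "\<dots> = (\<Sum>A\<in>fset (fPow C). (- 1) ^ ?l C * (?t A + ?t (finsert i A)))"
      by (simp only: sum_fPow_finsert[OF False] sum_distrib_left)
    also have "\<dots> = (\<Sum>A\<in>fset (fPow C).
       gsign A (C |-| A) * Poly_Mapping.lookup (pd i f) A * ?g (C |-| A)
        + gsign A (C |-| A) * Poly_Mapping.lookup (parity f) A
          * Poly_Mapping.lookup (pd i g) (C |-| A))"
    proof (rule sum.cong[OF refl])
      fix A assume "A \<in> fset (fPow C)"
      then have A: "A |\<subseteq>| C" by simp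
      then have i: "i |\<notin>| A" "i |\<notin>| C |-| A" using False by auto
      show "(- 1) ^ ?l C * (?t A + ?t (finsert i A)) =
        gsign A (C |-| A) * Poly_Mapping.lookup (pd i f) A * ?g (C |-| A)
        + gsign A (C |-| A) * Poly_Mapping.lookup (parity f) A
          * Poly_Mapping.lookup (pd i g) (C |-| A)"
        using i split[OF i(1)] l[OF A] unfolding d[OF A False]
        by (simp add: pd.rep_eq parity.rep_eq gsign_finsert_left gsign_finsert_right power_add
            algebra_simps left_minus_one_mult_self)
    qed
    also have "\<dots> = Poly_Mapping.lookup (pd i f \<star> g + parity f \<star> pd i g) C"
      by (simp only: lookup_add gmult.rep_eq sum.distrib)
    finally show ?thesis .
  qed
qed

lemma vop_rec: "vop i f = pd i f + xop i (xop (Suc i) (vop (i + 2) f))"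
proof -
  let ?T = "\<lambda>i k. foldr (\<circ>) (map xop [i..<i + 2 * k]) id (pd (i + 2 * k) f)"
  have pd0: "finite {j. pd j f \<noteq> 0}"
  proof (rule finite_subset)
    show "{j. pd j f \<noteq> 0} \<subseteq> (\<Union>A\<in>{A. Poly_Mapping.lookup f A \<noteq> 0}. fset A)"
    proof
      fix j assume "j \<in> {j. pd j f \<noteq> 0}"
      then obtain A where "Poly_Mapping.lookup (pd j f) A \<noteq> 0"
        by (metis (mono_tags) lookup_zero mem_Collect_eq poly_mapping_eqI)
      then have "Poly_Mapping.lookup f (finsert j A) \<noteq> 0"
        by (auto simp: pd.rep_eq split: if_splits)
      then show "j \<in> (\<Union>A\<in>{A. Poly_Mapping.lookup f A \<noteq> 0}. fset A)" by force
    qed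
  qed simp
  have zero: "foldr (\<circ>) (map xop js) id 0 = (0 :: 'a grassmann)" for js
    by (induction js) (simp_all add: xop_def)
  have fin: "finite {k. ?T j k \<noteq> 0}" for j
  proof (rule finite_subset)
    show "{k. ?T j k \<noteq> 0} \<subseteq> (\<lambda>k. j + 2 * k) -` {j. pd j f \<noteq> 0}"
      using zero by auto
    show "finite ((\<lambda>k. j + 2 * k) -` {j. pd j f \<noteq> 0})"
      by (rule finite_vimageI[OF pd0]) (simp add: inj_def)
  qed
  have shift: "?T i (Suc k) = xop i (xop (Suc i) (?T (i + 2) k))" for k
  proof -
    have "[i..<i + 2 * Suc k] = i # Suc i # [i + 2..<i + 2 + 2 * k]"
      by (simp add: upt_conv_Cons del: upt_Suc)
    then show ?thesis by simp
  qed
  have "finite ({k. ?T i k \<noteq> 0} \<union> {k. ?T (i + 2) k \<noteq> 0})"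
    using fin[of i] fin[of "i + 2"] by (rule finite_UnI)
  then obtain N where "\<forall>k\<in>{k. ?T i k \<noteq> 0} \<union> {k. ?T (i + 2) k \<noteq> 0}. k < N"
    unfolding finite_nat_set_iff_bounded by (rule exE)
  then have N: "k < N" if "?T i k \<noteq> 0 \<or> ?T (i + 2) k \<noteq> 0" for k
    using that by (metis (mono_tags, lifting) UnI1 UnI2 mem_Collect_eq)
  have N1: "{k. ?T i k \<noteq> 0} \<subseteq> {..<Suc N}" and N2: "{k. ?T (i + 2) k \<noteq> 0} \<subseteq> {..<N}"
    using N by (metis (mono_tags, lifting) less_SucI lessThan_iff mem_Collect_eq subsetI)+
  have "vop i f = sum (?T i) {..<Suc N}"
    unfolding vop_def by (rule Sum_any.expand_superset[OF finite_lessThan N1])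
  also have "\<dots> = pd i f + (\<Sum>k<N. xop i (xop (Suc i) (?T (i + 2) k)))"
    by (simp only: sum.lessThan_Suc_shift shift) simp
  also have "(\<Sum>k<N. xop i (xop (Suc i) (?T (i + 2) k))) = xop i (xop (Suc i) (sum (?T (i + 2)) {..<N}))"
  proof -
    have "xop j (sum h {..<n}) = (\<Sum>k<n. xop j (h k :: 'a grassmann))" for j h and n :: nat
      by (induction n) (simp_all add: xop_def gmult_add_right)
    then show ?thesis by simp
  qed
  also have "sum (?T (i + 2)) {..<N} = vop (i + 2) f"
    unfolding vop_def by (rule Sum_any.expand_superset[OF finite_lessThan N2, symmetric])
  finally show ?thesis .
qed


section \<open>Standard monomials and their weights\<close>

text \<open>The upper index is an integer, so that \<open>r\<^sub>m\<close> is the identity for negative \<open>m\<close>.\<close>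

definition tail_monomial :: "(nat \<Rightarrow> nat) \<Rightarrow> int \<Rightarrow> 'k::field grassmann \<Rightarrow> 'k grassmann" where
  "tail_monomial \<xi> m = foldr (\<circ>) (map (\<lambda>i. xop i ^^ \<xi> i) [0..<nat (m + 1)]) id"

definition first_type :: "('k::field grassmann \<Rightarrow> 'k grassmann) set" where
  "first_type = {tail_monomial \<xi> (int n - 2) \<circ> vop n | \<xi> n. \<forall>i. \<xi> i \<in> {0, 1}}"

definition second_type :: "('k::field grassmann \<Rightarrow> 'k grassmann) set" where
  "second_type =
     {tail_monomial \<xi> (int n - 3) \<circ> xop (n - 1) \<circ> vop n | \<xi> n. n \<ge> 2 \<and> (\<forall>i. \<xi> i \<in> {0, 1})}
     - {xop 0 \<circ> xop 2 \<circ> vop 3}"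

definition standard_monomials :: "('k::field grassmann \<Rightarrow> 'k grassmann) set" where
  "standard_monomials = first_type \<union> second_type"

inductive has_wt :: "('k::field grassmann \<Rightarrow> 'k grassmann) \<Rightarrow> int \<Rightarrow> bool" where
  "has_wt id 0"
| "has_wt (xop n) (- (2 ^ n))"
| "has_wt (vop n) (2 ^ n)"
| "has_wt a p \<Longrightarrow> has_wt b q \<Longrightarrow> has_wt (a \<circ> b) (p + q)"

inductive has_swt :: "('k::field grassmann \<Rightarrow> 'k grassmann) \<Rightarrow> int \<Rightarrow> bool" where
  "has_swt id 0"
| "has_swt (xop n) (- ((- 1) ^ n))"
| "has_swt (vop n) ((- 1) ^ n)"
| "has_swt a p \<Longrightarrow> has_swt b q \<Longrightarrow> has_swt (a \<circ> b) (p + q)"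

text \<open>Nonzero monomials in the \<open>x\<^sub>i\<close>, \<open>v\<^sub>i\<close> have a unique weight and superweight: \<open>x\<^sub>i\<close> and \<open>v\<^sub>i\<close>
  are homogeneous for the gradings of the Grassmann algebra in which \<open>x\<^sub>i\<close> has degree
  \<open>-2\<^sup>i\<close> and \<open>-(-1)\<^sup>i\<close>, respectively.\<close>

definition wt :: "('k::field grassmann \<Rightarrow> 'k grassmann) \<Rightarrow> int" where
  "wt a = (THE p. has_wt a p)"

definition swt :: "('k::field grassmann \<Rightarrow> 'k grassmann) \<Rightarrow> int" where
  "swt a = (THE p. has_swt a p)"

end

theory Submission
  imports Defs
begin

text \<open>Give \<open>x\<^sub>i\<close> a degree \<open>- g i\<close> with \<open>g (i + 2) = 2 g i + g (i + 1)\<close>, as is the case for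
  \<open>g i = 2\<^sup>i\<close> and \<open>g i = (-1)\<^sup>i\<close>. Then \<open>v\<^sub>i\<close> is homogeneous of degree \<open>g i\<close>, so a monomial that does
  not vanish on some basis element has a unique weight and superweight; for \<open>r v\<^sub>n\<close> such an element
  is \<open>x\<^sub>n\<close>, since \<open>v\<^sub>n x\<^sub>n = 1\<close>. The geometric series then gives \<open>wt w \<ge> 2\<^bsup>n-1\<^esup>\<close> for the first type
  and \<open>wt w > 2\<^bsup>n-2\<^esup>\<close> for the second, while the superweight of a tail in \<open>x\<^sub>0, \<dots>, x\<^bsub>m-1\<^esub>\<close> lies
  between \<open>- (m + 1) / 2\<close> and \<open>m / 2\<close>.\<close>

section \<open>Homogeneous elements and operators\<close>

text \<open>Zero is homogeneous of every degree, so operators may kill elements freely. The price is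
  that a degree is determined only by a nonzero element.\<close>

definition homogeneous :: "(nat \<Rightarrow> int) \<Rightarrow> int \<Rightarrow> 'k::field grassmann \<Rightarrow> bool" where
  "homogeneous g d f \<longleftrightarrow>
    (\<forall>A. Poly_Mapping.lookup f A \<noteq> 0 \<longrightarrow> - (\<Sum>i\<in>fset A. g i) = d)"

definition homogeneous_op ::
  "(nat \<Rightarrow> int) \<Rightarrow> int \<Rightarrow> ('k::field grassmann \<Rightarrow> 'k grassmann) \<Rightarrow> bool" where
  "homogeneous_op g p a \<longleftrightarrow> (\<forall>d f. homogeneous g d f \<longrightarrow> homogeneous g (d + p) (a f))"

lemma homogeneous_op_id: "homogeneous_op g 0 id"
  by (simp add: homogeneous_op_def)

lemma homogeneous_op_comp:
  fixes a b :: "'k::field grassmann \<Rightarrow> 'k grassmann"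
  assumes "homogeneous_op g p a" "homogeneous_op g q b"
  shows "homogeneous_op g (p + q) (a \<circ> b)"
  unfolding homogeneous_op_def
proof (intro allI impI)
  fix d and f :: "'k grassmann" assume "homogeneous g d f"
  then have "homogeneous g (d + q + p) (a (b f))"
    using assms unfolding homogeneous_op_def by blast
  then show "homogeneous g (d + (p + q)) ((a \<circ> b) f)" by (simp add: ac_simps)
qed

lemma homogeneous_op_xop: "homogeneous_op g (- g i) (xop i :: 'k::field grassmann \<Rightarrow> _)"
  unfolding homogeneous_op_def homogeneous_def
proof (intro allI impI)
  fix d A and f :: "'k grassmann"
  assume f: "\<forall>A. Poly_Mapping.lookup f A \<noteq> 0 \<longrightarrow> - (\<Sum>i\<in>fset A. g i) = d"
    and "Poly_Mapping.lookup (xop i f) A \<noteq> 0"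
  then have i: "i \<in> fset A" and "Poly_Mapping.lookup f (A |-| {|i|}) \<noteq> 0"
    by (auto simp: lookup_xop split: if_splits)
  with f have "- (\<Sum>j\<in>fset A - {i}. g j) = d" by fastforce
  moreover have "(\<Sum>j\<in>fset A. g j) = g i + (\<Sum>j\<in>fset A - {i}. g j)"
    using i by (intro sum.remove) auto
  ultimately show "- (\<Sum>j\<in>fset A. g j) = d + - g i" by simp
qed

lemma homogeneous_op_pd: "homogeneous_op g (g i) (pd i :: 'k::field grassmann \<Rightarrow> _)"
  unfolding homogeneous_op_def homogeneous_def
proof (intro allI impI)
  fix d A and f :: "'k grassmann"
  assume f: "\<forall>A. Poly_Mapping.lookup f A \<noteq> 0 \<longrightarrow> - (\<Sum>i\<in>fset A. g i) = d"
    and "Poly_Mapping.lookup (pd i f) A \<noteq> 0"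
  then have "i \<notin> fset A" and "Poly_Mapping.lookup f (finsert i A) \<noteq> 0"
    by (auto simp: pd.rep_eq split: if_splits)
  with f show "- (\<Sum>j\<in>fset A. g j) = d + g i" by fastforce
qed

lemma homogeneous_op_xops:
  "homogeneous_op g (- (\<Sum>i\<leftarrow>is. g i)) (foldr (\<circ>) (map xop is) id :: 'k::field grassmann \<Rightarrow> _)"
proof (induction "is")
  case Nil
  then show ?case using homogeneous_op_id[of g] by (simp add: id_def)
next
  case (Cons i "is")
  have "homogeneous_op g (- g i + - (\<Sum>i\<leftarrow>is. g i))
      (foldr (\<circ>) (map xop (i # is)) id :: 'k grassmann \<Rightarrow> _)"
    by (simp only: list.map foldr_Cons o_apply) (rule homogeneous_op_comp[OF homogeneous_op_xop Cons])
  then show ?case by (simp only: list.map sum_list.Cons minus_add_distrib)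
qed

lemma homogeneous_sum:
  assumes "\<And>k. k \<in> S \<Longrightarrow> homogeneous g d (h k)"
  shows "homogeneous g d (sum h S)"
  unfolding homogeneous_def
proof (intro allI impI)
  fix A assume "Poly_Mapping.lookup (sum h S) A \<noteq> 0"
  then have "(\<Sum>k\<in>S. Poly_Mapping.lookup (h k) A) \<noteq> 0" by (simp add: lookup_sum)
  then obtain k where "k \<in> S" "Poly_Mapping.lookup (h k) A \<noteq> 0"
    by (meson sum.not_neutral_contains_not_neutral)
  with assms show "- (\<Sum>i\<in>fset A. g i) = d" unfolding homogeneous_def by blast
qed

text \<open>The \<open>k\<close>-th summand of \<open>vop i\<close> has degree
  \<open>g (i + 2 * k)\<close> minus the sum of \<open>g j\<close> over
  \<open>i \<le> j < i + 2 * k\<close>. Passing to \<open>k + 1\<close> changes this by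
  \<open>g (i + 2 * k + 2) - 2 * g (i + 2 * k) - g (i + 2 * k + 1)\<close>, which the recurrence
  makes 0. So every summand has the degree \<open>g i\<close> of the first one.\<close>

lemma homogeneous_op_vop:
  assumes g: "\<And>i. g (i + 2) = 2 * g i + g (i + 1)"
  shows "homogeneous_op g (g i) (vop i :: 'k::field grassmann \<Rightarrow> _)"
  unfolding homogeneous_op_def
proof (intro allI impI)
  fix d and f :: "'k grassmann"
  assume f: "homogeneous g d f"
  have deg: "g (i + 2 * k) - (\<Sum>j\<leftarrow>[i..<i + 2 * k]. g j) = g i" for k
    using g[of "i + 2 * _"] by (induction k) simp_all
  have "homogeneous g (d + g i) (foldr (\<circ>) (map xop [i..<i + 2 * k]) id (pd (i + 2 * k) f))" for k
    using homogeneous_op_comp[OF homogeneous_op_xops[of g "[i..<i + 2 * k]"] homogeneous_op_pd]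
      f deg[of k]
    unfolding homogeneous_op_def o_apply by (metis add.commute diff_conv_add_uminus)
  \<comment> \<open>\<open>Sum_any\<close> unfolds to an ordinary sum over the indices of nonzero
    summands, all homogeneous of the same degree.\<close>
  then show "homogeneous g (d + g i) (vop i f)"
    unfolding vop_def Sum_any.expand_set by (rule homogeneous_sum)
qed

text \<open>The basis elements indexed by \<open>A\<close> and \<open>B\<close> are nonzero, so each
  has exactly one degree. Any degree of \<open>a\<close> is the difference of these two.\<close>

lemma homogeneous_op_unique:
  assumes "homogeneous_op g p a" "homogeneous_op g q a"
    and "a (Poly_Mapping.single A 1) = Poly_Mapping.single B (1 :: 'k::field)"
  shows "p = q"
proof -
  have "homogeneous g (- (\<Sum>i\<in>fset A. g i)) (Poly_Mapping.single A (1 :: 'k))"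
    by (simp add: homogeneous_def lookup_single when_def)
  then have "homogeneous g (- (\<Sum>i\<in>fset A. g i) + r) (Poly_Mapping.single B (1 :: 'k))"
    if "homogeneous_op g r a" for r
    using that assms(3) unfolding homogeneous_op_def by metis
  then have "- (\<Sum>i\<in>fset B. g i) = - (\<Sum>i\<in>fset A. g i) + r" if "homogeneous_op g r a" for r
    using that by (fastforce simp: homogeneous_def lookup_single when_def)
  from this[OF assms(1)] this[OF assms(2)] show ?thesis by simp
qed


section \<open>Uniqueness of the weight and superweight\<close>

text \<open>The recurrence for \<open>g\<close> has characteristic equation
  \<open>t^2 = t + 2\<close> with roots 2 and -1. These give the weight here and the superweight
  below.\<close>

lemma has_wt_homogeneous_op: "has_wt a p \<Longrightarrow> homogeneous_op (\<lambda>i. 2 ^ i) p a"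
proof (induction rule: has_wt.induct)
  case (2 n)
  show ?case using homogeneous_op_xop[of "\<lambda>i. 2 ^ i" n] by simp
next
  case (3 n)
  show ?case using homogeneous_op_vop[of "\<lambda>i. 2 ^ i" n] by simp
qed (rule homogeneous_op_id, rule homogeneous_op_comp)

lemma has_swt_homogeneous_op: "has_swt a p \<Longrightarrow> homogeneous_op (\<lambda>i. (- 1) ^ i) p a"
proof (induction rule: has_swt.induct)
  case (2 n)
  show ?case using homogeneous_op_xop[of "\<lambda>i. (- 1) ^ i" n] by simp
next
  case (3 n)
  show ?case using homogeneous_op_vop[of "\<lambda>i. (- 1) ^ i" n] by simp
qed (rule homogeneous_op_id, rule homogeneous_op_comp)

text \<open>\<open>wt\<close> is a definite description, and the same operator may be written as a
  product in several ways. Each way yields a degree of the operator, and a basis element sent to a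
  basis element fixes that degree.\<close>

lemma wt_eqI:
  assumes "has_wt a p" "a (Poly_Mapping.single A 1) = Poly_Mapping.single B 1"
  shows "wt a = p"
  unfolding wt_def
  using assms by (intro the_equality) (auto dest!: has_wt_homogeneous_op intro: homogeneous_op_unique)

lemma swt_eqI:
  assumes "has_swt a p" "a (Poly_Mapping.single A 1) = Poly_Mapping.single B 1"
  shows "swt a = p"
  unfolding swt_def
  using assms by (intro the_equality) (auto dest!: has_swt_homogeneous_op intro: homogeneous_op_unique)


section \<open>Weights of standard monomials\<close>

lemma has_wt_xop_power: "has_wt (xop i ^^ k :: 'k::field grassmann \<Rightarrow> _) (- (int k * 2 ^ i))"
proof (induction k)
  case 0
  show ?case by (simp add: has_wt.intros(1) flip: id_def)
next
  case (Suc k)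
  have "has_wt (xop i ^^ Suc k :: 'k grassmann \<Rightarrow> _) (- (2 ^ i) + - (int k * 2 ^ i))"
    unfolding funpow.simps by (rule has_wt.intros(4)[OF has_wt.intros(2) Suc])
  then show ?case by (simp only: of_nat_Suc distrib_right mult_1 minus_add_distrib)
qed

lemma has_swt_xop_power: "has_swt (xop i ^^ k :: 'k::field grassmann \<Rightarrow> _) (- (int k * (- 1) ^ i))"
proof (induction k)
  case 0
  show ?case by (simp add: has_swt.intros(1) flip: id_def)
next
  case (Suc k)
  have "has_swt (xop i ^^ Suc k :: 'k grassmann \<Rightarrow> _) (- ((- 1) ^ i) + - (int k * (- 1) ^ i))"
    unfolding funpow.simps by (rule has_swt.intros(4)[OF has_swt.intros(2) Suc])
  then show ?case by (simp only: of_nat_Suc distrib_right mult_1 minus_add_distrib)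
qed

text \<open>An arbitrary list suits the induction: \<open>foldr\<close> peels off the first factor,
  and the rest of \<open>[0..<m]\<close> no longer starts at 0.\<close>

lemma has_wt_xop_powers:
  "has_wt (foldr (\<circ>) (map (\<lambda>i. xop i ^^ \<xi> i) is) id :: 'k::field grassmann \<Rightarrow> _)
    (- (\<Sum>i\<leftarrow>is. int (\<xi> i) * 2 ^ i))"
proof (induction "is")
  case Nil
  show ?case by (simp add: has_wt.intros(1) flip: id_def)
next
  case (Cons i "is")
  have "has_wt (foldr (\<circ>) (map (\<lambda>i. xop i ^^ \<xi> i) (i # is)) id :: 'k grassmann \<Rightarrow> _)
      (- (int (\<xi> i) * 2 ^ i) + - (\<Sum>i\<leftarrow>is. int (\<xi> i) * 2 ^ i))"
    by (simp only: list.map foldr_Cons o_apply) (rule has_wt.intros(4)[OF has_wt_xop_power Cons])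
  then show ?case by (simp only: list.map sum_list.Cons minus_add_distrib)
qed

lemma has_swt_xop_powers:
  "has_swt (foldr (\<circ>) (map (\<lambda>i. xop i ^^ \<xi> i) is) id :: 'k::field grassmann \<Rightarrow> _)
    (- (\<Sum>i\<leftarrow>is. int (\<xi> i) * (- 1) ^ i))"
proof (induction "is")
  case Nil
  show ?case by (simp add: has_swt.intros(1) flip: id_def)
next
  case (Cons i "is")
  have "has_swt (foldr (\<circ>) (map (\<lambda>i. xop i ^^ \<xi> i) (i # is)) id :: 'k grassmann \<Rightarrow> _)
      (- (int (\<xi> i) * (- 1) ^ i) + - (\<Sum>i\<leftarrow>is. int (\<xi> i) * (- 1) ^ i))"
    by (simp only: list.map foldr_Cons o_apply) (rule has_swt.intros(4)[OF has_swt_xop_power Cons])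
  then show ?case by (simp only: list.map sum_list.Cons minus_add_distrib)
qed

lemma has_wt_tail_monomial:
  "has_wt (tail_monomial \<xi> m) (- (\<Sum>i<nat (m + 1). int (\<xi> i) * 2 ^ i))"
  using has_wt_xop_powers[of \<xi> "[0..<nat (m + 1)]"]
  by (simp add: tail_monomial_def interv_sum_list_conv_sum_set_nat atLeast0LessThan)

lemma has_swt_tail_monomial:
  "has_swt (tail_monomial \<xi> m) (- (\<Sum>i<nat (m + 1). int (\<xi> i) * (- 1) ^ i))"
  using has_swt_xop_powers[of \<xi> "[0..<nat (m + 1)]"]
  by (simp add: tail_monomial_def interv_sum_list_conv_sum_set_nat atLeast0LessThan)

text \<open>Factors act from the last to the first, so each new index is smaller than all those
  present: no sign arises and no product vanishes. The bound on \<open>fset B\<close> is carried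
  along because the next step needs the new index to lie below every element of
  \<open>B\<close>.\<close>

lemma xop_powers_single:
  assumes \<xi>: "\<And>i. \<xi> i \<in> {0, 1 :: nat}"
    and "sorted_wrt (<) is" "\<And>i a. i \<in> set is \<Longrightarrow> a |\<in>| A \<Longrightarrow> i < a"
  shows "\<exists>B. fset B \<subseteq> set is \<union> fset A \<and>
    foldr (\<circ>) (map (\<lambda>i. xop i ^^ \<xi> i) is) id (Poly_Mapping.single A (1 :: 'k::field)) =
      Poly_Mapping.single B 1"
  using assms(2,3)
proof (induction "is")
  case Nil
  then show ?case by auto
next
  case (Cons i "is")
  have "sorted_wrt (<) is" "\<And>j a. j \<in> set is \<Longrightarrow> a |\<in>| A \<Longrightarrow> j < a"
    using Cons.prems by simp_all
  from Cons.IH[OF this] obtain B where B: "fset B \<subseteq> set is \<union> fset A"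
    "foldr (\<circ>) (map (\<lambda>i. xop i ^^ \<xi> i) is) id (Poly_Mapping.single A (1 :: 'k)) =
      Poly_Mapping.single B 1"
    by blast
  have "i < b" if "b |\<in>| B" for b
    using that B(1) Cons.prems by auto
  then have xop: "xop i (Poly_Mapping.single B (1 :: 'k)) = Poly_Mapping.single (finsert i B) 1"
    by (rule basis_increasing_product)
  consider "\<xi> i = 0" | "\<xi> i = 1" using \<xi>[of i] by auto
  then show ?case
  proof cases
    case 1
    then have "foldr (\<circ>) (map (\<lambda>i. xop i ^^ \<xi> i) (i # is)) id (Poly_Mapping.single A (1 :: 'k)) =
        Poly_Mapping.single B 1"
      using B(2) by (simp only: list.map foldr_Cons o_apply funpow_0 funpow.simps id_apply)
    moreover have "fset B \<subseteq> set (i # is) \<union> fset A" using B(1) by auto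
    ultimately show ?thesis by blast
  next
    case 2
    then have "foldr (\<circ>) (map (\<lambda>i. xop i ^^ \<xi> i) (i # is)) id (Poly_Mapping.single A (1 :: 'k)) =
        Poly_Mapping.single (finsert i B) 1"
      using B(2) xop by (simp only: list.map foldr_Cons o_apply funpow.simps One_nat_def id_apply)
    moreover have "fset (finsert i B) \<subseteq> set (i # is) \<union> fset A" using B(1) by auto
    ultimately show ?thesis by blast
  qed
qed

lemma tail_monomial_single:
  assumes "\<And>i. \<xi> i \<in> {0, 1}" "\<And>a. a |\<in>| A \<Longrightarrow> m < int a"
  obtains B where
    "tail_monomial \<xi> m (Poly_Mapping.single A (1 :: 'k::field)) = Poly_Mapping.single B 1"
proof -
  have "i < a" if "i \<in> set [0..<nat (m + 1)]" "a |\<in>| A" for i a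
    using that assms(2)[OF that(2)] by auto
  then have "\<exists>B. fset B \<subseteq> set [0..<nat (m + 1)] \<union> fset A \<and>
      tail_monomial \<xi> m (Poly_Mapping.single A (1 :: 'k)) = Poly_Mapping.single B 1"
    unfolding tail_monomial_def
    by (intro xop_powers_single[of \<xi> "[0..<nat (m + 1)]" A, OF assms(1) sorted_wrt_upt])
  then show thesis using that by blast
qed

text \<open>Only the summand \<open>k = 0\<close> survives, since for \<open>k > 0\<close> the
  derivative by the variable of index \<open>n + 2 * k\<close> kills \<open>gen n\<close>.\<close>

lemma vop_gen: "vop n (gen n) = (gone :: 'k::field grassmann)"
proof -
  have zero: "foldr (\<circ>) (map xop js) id 0 = (0 :: 'k grassmann)" for js
    by (induction js) (simp_all add: xop_def)
  have "vop n (gen n :: 'k grassmann) = Sum_any (\<lambda>k :: nat. if k = 0 then gone else 0)"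
    unfolding vop_def by (rule Sum_any.cong) (auto simp: pd_gen zero simp del: foldr_map)
  then show ?thesis by simp
qed

lemma first_type_weights:
  fixes n :: nat
  assumes "\<And>i. \<xi> i \<in> {0, 1}"
  defines "w \<equiv> tail_monomial \<xi> (int n - 2) \<circ> (vop n :: 'k::field grassmann \<Rightarrow> _)"
  shows "wt w = 2 ^ n - (\<Sum>i<n - 1. int (\<xi> i) * 2 ^ i)"
    and "swt w = (- 1) ^ n - (\<Sum>i<n - 1. int (\<xi> i) * (- 1) ^ i)"
proof -
  \<comment> \<open>For \<open>n = 0\<close> both sides are 0 by truncation, matching the empty
    tail.\<close>
  have m: "nat (int n - 2 + 1) = n - 1" by simp
  obtain B where "tail_monomial \<xi> (int n - 2) (Poly_Mapping.single {||} (1 :: 'k)) =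
      Poly_Mapping.single B 1"
    by (rule tail_monomial_single[of \<xi> "{||}" "int n - 2", OF assms(1)]) auto
  then have w: "w (Poly_Mapping.single {|n|} 1) = Poly_Mapping.single B 1"
    using vop_gen[of n, where 'k = 'k] by (simp add: w_def gen_def gone_def)
  show "wt w = 2 ^ n - (\<Sum>i<n - 1. int (\<xi> i) * 2 ^ i)"
    using wt_eqI[OF has_wt.intros(4)[OF has_wt_tail_monomial has_wt.intros(3)] w[unfolded w_def]]
    by (simp only: w_def m)
  show "swt w = (- 1) ^ n - (\<Sum>i<n - 1. int (\<xi> i) * (- 1) ^ i)"
    using swt_eqI[OF has_swt.intros(4)[OF has_swt_tail_monomial has_swt.intros(3)] w[unfolded w_def]]
    by (simp only: w_def m)
qed

lemma second_type_weights:
  fixes n :: nat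
  assumes "\<And>i. \<xi> i \<in> {0, 1}" and n: "n \<ge> 2"
  defines "w \<equiv> tail_monomial \<xi> (int n - 3) \<circ> xop (n - 1) \<circ> (vop n :: 'k::field grassmann \<Rightarrow> _)"
  shows "wt w = 2 ^ (n - 1) - (\<Sum>i<n - 2. int (\<xi> i) * 2 ^ i)"
    and "swt w = 2 * (- 1) ^ n - (\<Sum>i<n - 2. int (\<xi> i) * (- 1) ^ i)"
proof -
  have m: "nat (int n - 3 + 1) = n - 2" using n by simp
  \<comment> \<open>The factor of index \<open>n - 1\<close> halves the weight of
    \<open>vop n\<close> and doubles its superweight.\<close>
  have p: "(2 :: int) ^ n = 2 * 2 ^ (n - 1)" "(- 1 :: int) ^ n = - ((- 1) ^ (n - 1))"
    using n power_Suc[of "2 :: int" "n - 1"] power_Suc[of "- 1 :: int" "n - 1"] by simp_all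
  have "int n - 3 < int a" if "a |\<in>| {|n - 1|}" for a
    using that n by auto
  then obtain B where "tail_monomial \<xi> (int n - 3) (Poly_Mapping.single {|n - 1|} (1 :: 'k)) =
      Poly_Mapping.single B 1"
    by (rule tail_monomial_single[of \<xi> "{|n - 1|}" "int n - 3", OF assms(1)])
  moreover have "xop (n - 1) gone = Poly_Mapping.single {|n - 1|} (1 :: 'k)"
    unfolding gone_def by (rule basis_increasing_product) simp
  ultimately have w: "w (Poly_Mapping.single {|n|} 1) = Poly_Mapping.single B 1"
    using vop_gen[of n, where 'k = 'k] by (simp add: w_def gen_def)
  show "wt w = 2 ^ (n - 1) - (\<Sum>i<n - 2. int (\<xi> i) * 2 ^ i)"
    using wt_eqI[OF has_wt.intros(4)[OF has_wt.intros(4)[OF has_wt_tail_monomial has_wt.intros(2)]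
          has_wt.intros(3)] w[unfolded w_def]]
    by (simp only: w_def m p)
  show "swt w = 2 * (- 1) ^ n - (\<Sum>i<n - 2. int (\<xi> i) * (- 1) ^ i)"
    using swt_eqI[OF has_swt.intros(4)[OF has_swt.intros(4)[OF has_swt_tail_monomial
            has_swt.intros(2)] has_swt.intros(3)] w[unfolded w_def]]
    by (simp only: w_def m p)
qed


section \<open>Bounds\<close>

lemma tail_weight_less:
  assumes "\<And>i. \<xi> i \<in> {0, 1}"
  shows "(\<Sum>i<m. int (\<xi> i) * 2 ^ i) < 2 ^ m"
proof (induction m)
  case (Suc m)
  have "\<xi> m = 0 \<or> \<xi> m = 1" using assms[of m] by auto
  then have "int (\<xi> m) * 2 ^ m \<le> 2 ^ m" by auto
  moreover have "(\<Sum>i<Suc m. int (\<xi> i) * 2 ^ i) = (\<Sum>i<m. int (\<xi> i) * 2 ^ i) + int (\<xi> m) * 2 ^ m"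
    by simp
  ultimately show ?case using Suc unfolding power_Suc by linarith
qed simp

text \<open>Even indices contribute 0 or 1 and odd ones 0 or -1, so \<open>T m\<close> is bounded by
  the numbers of even and odd indices below \<open>m\<close>. Doubling keeps the bounds
  integral.\<close>

lemma tail_superweight_bounds:
  assumes "\<And>i. \<xi> i \<in> {0, 1}"
  defines "T \<equiv> \<lambda>m. \<Sum>i<m. int (\<xi> i) * (- 1) ^ i"
  shows "- int m \<le> 2 * T m \<and> 2 * T m \<le> int m + 1"
proof -
  \<comment> \<open>The exact counts, with their parity term, are needed for the induction: one step
    can change \<open>2 * T m\<close> by 2, whereas the bounds claimed move only by 1.\<close>
  have "int (m mod 2) - int m \<le> 2 * T m \<and> 2 * T m \<le> int m + int (m mod 2)"
  proof (induction m)
    case (Suc m)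
    have "\<xi> m = 0 \<or> \<xi> m = 1" using assms(1)[of m] by auto
    moreover have "T (Suc m) = T m + int (\<xi> m) * (- 1) ^ m" by (simp add: T_def)
    ultimately show ?case using Suc by (cases "even m") (auto simp: mod_Suc mod2_eq_if)
  qed (simp add: T_def)
  moreover have "m mod 2 \<le> 1" by simp
  ultimately show ?thesis by linarith
qed

theorem theorem7p4:
  fixes w :: "'k::field grassmann \<Rightarrow> 'k grassmann"
    and Z1 Z2 :: int
  assumes "w \<in> standard_monomials"
    and "(Z1, Z2) = (wt w, swt w)"
  shows "- (1 / 2) * log 2 (real_of_int Z1) - 5 / 2 < real_of_int Z2 \<and>
      real_of_int Z2 < 1 / 2 * log 2 (real_of_int Z1) + 2"
proof -
  have log_gt: "real m < log 2 (real_of_int z)" if "2 ^ m < z" for m z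
  proof -
    have "(2 :: real) ^ m < real_of_int z" using that by (metis of_int_less_iff of_int_numeral of_int_power)
    then show ?thesis by (simp add: less_log_of_power)
  qed
  consider (first) \<xi> n where "w = tail_monomial \<xi> (int n - 2) \<circ> vop n" "\<And>i. \<xi> i \<in> {0, 1}"
    | (second) \<xi> n where "w = tail_monomial \<xi> (int n - 3) \<circ> xop (n - 1) \<circ> vop n" "n \<ge> 2"
        "\<And>i. \<xi> i \<in> {0, 1}"
    using assms(1) unfolding standard_monomials_def first_type_def second_type_def by blast
  then show ?thesis
  proof cases
    case first
    define T where "T = (\<Sum>i<n - 1. int (\<xi> i) * (- 1) ^ i)"
    have Z: "Z1 = 2 ^ n - (\<Sum>i<n - 1. int (\<xi> i) * 2 ^ i)" "Z2 = (- 1) ^ n - T"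
      using assms(2) first_type_weights[of \<xi> n, OF first(2), where 'k = 'k] first(1) by (auto simp: T_def)
    \<comment> \<open>Equality occurs for \<open>n = 0\<close>, where \<open>Z1 = 1\<close> and
      \<open>n - 1\<close> truncates to 0.\<close>
    have "real (n - 1) \<le> log 2 (real_of_int Z1)"
    proof (cases n)
      case 0
      then show ?thesis using Z(1) by simp
    next
      case (Suc m)
      then have "2 ^ m < Z1" using Z(1) tail_weight_less[of \<xi> m, OF first(2)] by simp
      then have "real m < log 2 (real_of_int Z1)" by (rule log_gt)
      then show ?thesis using Suc by simp
    qed
    moreover have "- int (n - 1) \<le> 2 * T \<and> 2 * T \<le> int (n - 1) + 1"
      unfolding T_def using first(2) by (rule tail_superweight_bounds)
    then have "- real (n - 1) \<le> 2 * real_of_int T \<and> 2 * real_of_int T \<le> real (n - 1) + 1"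
      by linarith
    moreover have "real_of_int Z2 = 1 - real_of_int T \<or> real_of_int Z2 = - 1 - real_of_int T"
      using Z(2) by (cases "even n") auto
    \<comment> \<open>Here \<open>Z2\<close> lies between \<open>- 3 / 2 - (n - 1) / 2\<close> and
      \<open>1 + (n - 1) / 2\<close>. Both constants leave a slack of 1, so the non-strict bound on
      the logarithm suffices.\<close>
    ultimately show ?thesis by argo
  next
    case second
    define m where "m = n - 2"
    have n: "n - 1 = Suc m" using second(2) by (simp add: m_def)
    define T where "T = (\<Sum>i<m. int (\<xi> i) * (- 1) ^ i)"
    have Z: "Z1 = 2 ^ Suc m - (\<Sum>i<m. int (\<xi> i) * 2 ^ i)" "Z2 = 2 * (- 1) ^ n - T"
      using assms(2) second_type_weights[of \<xi> n, OF second(3,2), where 'k = 'k] second(1) n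
      by (auto simp: T_def m_def)
    then have "2 ^ m < Z1" using tail_weight_less[of \<xi> m, OF second(3)] by simp
    then have "real m < log 2 (real_of_int Z1)" by (rule log_gt)
    moreover have "- int m \<le> 2 * T \<and> 2 * T \<le> int m + 1"
      unfolding T_def using second(3) by (rule tail_superweight_bounds)
    then have "- real m \<le> 2 * real_of_int T \<and> 2 * real_of_int T \<le> real m + 1"
      by linarith
    moreover have "real_of_int Z2 = 2 - real_of_int T \<or> real_of_int Z2 = - 2 - real_of_int T"
      using Z(2) by (cases "even n") auto
    \<comment> \<open>Here \<open>Z2\<close> lies between \<open>- 5 / 2 - m / 2\<close> and
      \<open>2 + m / 2\<close>, which are exactly the constants of the theorem. Strictness comes
      from \<open>m < log 2 Z1\<close>.\<close>
    ultimately show ?thesis by argo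
  qed
qed

end
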